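(* Let $G$ be a $Pm$-factorizable topological group and $K$ an arbitrary compact topological group. Then the topological group $G\times K$ is $Pm$-factorizable.
   Context: All topological spaces (in particular all topological groups) are assumed Hausdorff. A continuous map $f:X\to Y$ is perfect if it is closed, onto, and all fibers $f^{-1}(y)$ are compact; a perfect homomorphism is a continuous group homomorphism that is a perfect map. A topological group $G$ is $Pm$-factorizable if for every continuous mapping $f:G\to M$ to a metrizable space $M$ there are a perfect homomorphism $\pi:G\to L$ onto a second-countable topological group $L$ and a continuous mapping $g:L\to M$ such that $f=g\circ\pi$. *)

theory Defs
  imports "HOL-Analysis.Analysis" "HOL-Algebra.Group"
begin

text \<open>All topological groups are Hausdorff.\<close>

locale topological_group = group G for G (structure) +
  fixes T :: "'a topology"
  assumes topspace_eq: "topspace T = carrier G"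
    and Hausdorff: "Hausdorff_space T"
    and continuous_mult: "continuous_map (prod_topology T T) T (\<lambda>(x, y). x \<otimes> y)"
    and continuous_inv: "continuous_map T T (\<lambda>x. inv x)"

definition perfect_homomorphism ::
  "('a, 'c) monoid_scheme \<Rightarrow> 'a topology \<Rightarrow> ('b, 'd) monoid_scheme \<Rightarrow> 'b topology \<Rightarrow> ('a \<Rightarrow> 'b) \<Rightarrow> bool"
  where "perfect_homomorphism G TG L TL \<pi> \<longleftrightarrow> \<pi> \<in> hom G L \<and> perfect_map TG TL \<pi>"

text \<open>
  The spaces \<open>M\<close> and the groups \<open>L\<close> of the mathematical definition are arbitrary, whereas a HOL
  definition cannot quantify over types. Here both live on subsets of the type of the elements of
  \<open>G\<close>. This loses nothing: \<open>M\<close> matters only through the image of \<open>f\<close>, and \<open>L\<close> is an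
  image of \<open>G\<close>. The lemmas \<open>Pm_factorizableD\<close> and \<open>Pm_factorizableI\<close> below show that one may
  replace the type of \<open>M\<close> and the type of \<open>L\<close> by any others.
\<close>

definition Pm_factorizable :: "('a, 'c) monoid_scheme \<Rightarrow> 'a topology \<Rightarrow> bool"
  where "Pm_factorizable G T \<longleftrightarrow>
    topological_group G T \<and>
    (\<forall>(M :: 'a topology) f. metrizable_space M \<and> continuous_map T M f \<longrightarrow>
      (\<exists>(L :: 'a monoid) TL \<pi> g.
        topological_group L TL \<and> second_countable TL \<and>
        perfect_homomorphism G T L TL \<pi> \<and>
        continuous_map TL M g \<and> (\<forall>x\<in>carrier G. f x = g (\<pi> x))))"

lemma homeomorphic_map_pullback:
  assumes "inj_on q A" "q ` A = topspace Y"
  shows "topspace (pullback_topology A q Y) = A"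
    and "homeomorphic_map (pullback_topology A q Y) Y q"
proof -
  let ?P = "pullback_topology A q Y"
  show top: "topspace ?P = A"
    using assms by (auto simp: topspace_pullback_topology)
  have "continuous_map ?P Y q"
    using continuous_map_pullback[of Y Y id A q] by simp
  moreover have "open_map ?P Y q"
    unfolding open_map_def
  proof (intro allI impI)
    fix S assume "openin ?P S"
    then obtain U where U: "openin Y U" "S = q -` U \<inter> A"
      by (auto simp: openin_pullback_topology)
    have "q ` (q -` U \<inter> A) = U \<inter> q ` A"
      by blast
    then have "q ` S = U"
      using U openin_subset[OF U(1)] assms(2) by (simp add: inf.absorb1)
    then show "openin Y (q ` S)" using U by simp
  qed
  ultimately show "homeomorphic_map ?P Y q"
    using assms top by (simp add: bijective_open_imp_homeomorphic_map)
qed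

lemma Pm_factorizableD:
  fixes G :: "('a, 'c) monoid_scheme" and M :: "'m topology"
  assumes "Pm_factorizable G T" "metrizable_space M" "continuous_map T M f"
  shows "\<exists>(L :: 'a monoid) TL \<pi> g.
    topological_group L TL \<and> second_countable TL \<and> perfect_homomorphism G T L TL \<pi> \<and>
    continuous_map TL M g \<and> (\<forall>x\<in>carrier G. f x = g (\<pi> x))"
proof -
  have top: "topspace T = carrier G"
    using assms(1) unfolding Pm_factorizable_def by (simp add: topological_group.topspace_eq)
  define Y where "Y = subtopology M (f ` carrier G)"
  define A where "A = inv_into (carrier G) f ` f ` carrier G"
  define Y' where "Y' = pullback_topology A f Y"
  have "f ` carrier G \<subseteq> topspace M"
    using assms(3) top continuous_map_image_subset_topspace by metis
  then have topY: "topspace Y = f ` carrier G"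
    by (auto simp: Y_def)
  have fs: "f (inv_into (carrier G) f y) = y" if "y \<in> f ` carrier G" for y
    using that by (rule f_inv_into_f)
  have "inj_on f A"
    unfolding A_def by (rule inj_onI) (auto simp: fs)
  moreover have "f ` A = topspace Y"
    unfolding A_def topY image_image using fs by force
  ultimately have hom: "homeomorphic_map Y' Y f"
    unfolding Y'_def by (rule homeomorphic_map_pullback)
  then obtain r where r: "homeomorphic_maps Y' Y f r"
    using homeomorphic_map_maps by blast
  have "metrizable_space Y"
    unfolding Y_def by (rule metrizable_space_subtopology[OF assms(2)])
  then have met: "metrizable_space Y'"
    using hom homeomorphic_metrizable_space homeomorphic_map_imp_homeomorphic_space by blast
  have "continuous_map T Y f"
    unfolding Y_def using assms(3) top by (simp add: continuous_map_in_subtopology)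
  then have "continuous_map T Y' (r \<circ> f)"
    using r continuous_map_compose unfolding homeomorphic_maps_def by blast
  then obtain L :: "'a monoid" and TL \<pi> g where
    L: "topological_group L TL" "second_countable TL" "perfect_homomorphism G T L TL \<pi>"
    and g: "continuous_map TL Y' g" "\<forall>x\<in>carrier G. (r \<circ> f) x = g (\<pi> x)"
    using assms(1) met unfolding Pm_factorizable_def by blast
  have "continuous_map TL Y (f \<circ> g)"
    using g(1) r continuous_map_compose unfolding homeomorphic_maps_def by blast
  then have "continuous_map TL M (f \<circ> g)"
    unfolding Y_def by (simp add: continuous_map_in_subtopology)
  moreover have "f x = (f \<circ> g) (\<pi> x)" if "x \<in> carrier G" for x
    using g(2) that r topY unfolding homeomorphic_maps_def by force
  ultimately show ?thesis using L by blast
qed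

lemma Pm_factorizableI:
  fixes G :: "('a, 'c) monoid_scheme"
  assumes G: "topological_group G T"
    and fac: "\<And>(M :: 'a topology) f. metrizable_space M \<Longrightarrow> continuous_map T M f \<Longrightarrow>
      \<exists>(L :: 'l monoid) TL \<pi> g.
        topological_group L TL \<and> second_countable TL \<and> perfect_homomorphism G T L TL \<pi> \<and>
        continuous_map TL M g \<and> (\<forall>x\<in>carrier G. f x = g (\<pi> x))"
  shows "Pm_factorizable G T"
  unfolding Pm_factorizable_def
proof (intro conjI G allI impI, elim conjE)
  fix M :: "'a topology" and f
  assume "metrizable_space M" "continuous_map T M f"
  then obtain L :: "'l monoid" and TL \<pi> g where
    L: "topological_group L TL" and sc: "second_countable TL"
    and \<pi>: "perfect_homomorphism G T L TL \<pi>"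
    and g: "continuous_map TL M g" "\<forall>x\<in>carrier G. f x = g (\<pi> x)"
    using fac by blast
  interpret G: topological_group G T by (rule G)
  interpret L: topological_group L TL by (rule L)
  have img: "\<pi> ` carrier G = carrier L"
    using \<pi> G.topspace_eq L.topspace_eq unfolding perfect_homomorphism_def perfect_map_def by simp
  define s where "s = inv_into (carrier G) \<pi>"
  define A where "A = s ` carrier L"
  define TA where "TA = pullback_topology A \<pi> TL"
  define H :: "'a monoid" where
    "H = \<lparr>carrier = A, mult = (\<lambda>x y. s (\<pi> x \<otimes>\<^bsub>L\<^esub> \<pi> y)), one = s \<one>\<^bsub>L\<^esub>\<rparr>"
  have \<pi>s: "\<pi> (s y) = y" if "y \<in> carrier L" for y
    using that img unfolding s_def by (metis f_inv_into_f)
  have s\<pi>: "s (\<pi> x) = x" if "x \<in> A" for x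
    using that \<pi>s by (auto simp: A_def)
  have sA: "s y \<in> A" if "y \<in> carrier L" for y
    using that by (simp add: A_def)
  have \<pi>A: "\<pi> x \<in> carrier L" if "x \<in> A" for x
    using that \<pi>s by (auto simp: A_def)
  have inj: "inj_on \<pi> A"
    by (rule inj_onI) (metis s\<pi>)
  have im: "\<pi> ` A = topspace TL"
    unfolding A_def L.topspace_eq image_image using \<pi>s by simp
  have topA: "topspace TA = A" and hom: "homeomorphic_map TA TL \<pi>"
    unfolding TA_def using homeomorphic_map_pullback[OF inj im] by auto
  have c\<pi>: "continuous_map TA TL \<pi>"
    using hom by (rule homeomorphic_imp_continuous_map)
  have homs: "homeomorphic_map TL TA s"
  proof -
    obtain r where r: "homeomorphic_maps TA TL \<pi> r"
      using hom homeomorphic_map_maps by blast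
    then have "homeomorphic_map TL TA r"
      using homeomorphic_maps_map by blast
    moreover have "r y = s y" if "y \<in> topspace TL" for y
    proof -
      have "r y \<in> A" "\<pi> (r y) = y"
        using r that topA unfolding homeomorphic_maps_def continuous_map_def by auto
      then show ?thesis using s\<pi> by metis
    qed
    ultimately show ?thesis
      using homeomorphic_map_eq by blast
  qed
  have cs: "continuous_map TL TA s"
    using homs by (rule homeomorphic_imp_continuous_map)
  have grp: "group H"
  proof (rule groupI)
    show "\<exists>y\<in>carrier H. y \<otimes>\<^bsub>H\<^esub> x = \<one>\<^bsub>H\<^esub>" if "x \<in> carrier H" for x
      using that by (intro bexI[of _ "s (inv\<^bsub>L\<^esub> (\<pi> x))"]) (auto simp: H_def \<pi>s \<pi>A sA)
  qed (auto simp: H_def sA \<pi>A \<pi>s s\<pi> L.m_assoc)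
  interpret H: group H by (rule grp)
  have inv: "s (inv\<^bsub>L\<^esub> (\<pi> x)) = inv\<^bsub>H\<^esub> x" if "x \<in> A" for x
    by (rule H.inv_equality[symmetric]) (use that in \<open>auto simp: H_def \<pi>s \<pi>A sA\<close>)
  have "topological_group H TA"
  proof (unfold_locales)
    show "topspace TA = carrier H"
      by (simp add: topA H_def)
    show "Hausdorff_space TA"
      using hom L.Hausdorff homeomorphic_Hausdorff_space homeomorphic_map_imp_homeomorphic_space
      by blast
    have "continuous_map (prod_topology TA TA) (prod_topology TL TL) (\<lambda>z. (\<pi> (fst z), \<pi> (snd z)))"
      using continuous_map_compose[OF continuous_map_fst c\<pi>, of TA]
        continuous_map_compose[OF continuous_map_snd c\<pi>, of TA]
      by (simp add: continuous_map_paired o_def)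
    from continuous_map_compose[OF continuous_map_compose[OF this L.continuous_mult] cs]
    show "continuous_map (prod_topology TA TA) TA (\<lambda>(x, y). x \<otimes>\<^bsub>H\<^esub> y)"
      by (simp add: H_def o_def case_prod_beta')
    from continuous_map_compose[OF continuous_map_compose[OF c\<pi> L.continuous_inv] cs]
    show "continuous_map TA TA (\<lambda>x. inv\<^bsub>H\<^esub> x)"
      by (rule continuous_map_eq) (simp add: topA inv)
  qed
  moreover have "second_countable TA"
    using hom sc homeomorphic_space_second_countability homeomorphic_map_imp_homeomorphic_space
    by blast
  moreover have "perfect_homomorphism G T H TA (s \<circ> \<pi>)"
    unfolding perfect_homomorphism_def
  proof
    have "\<pi> \<in> hom G L" and pm: "perfect_map T TL \<pi>"
      using \<pi> by (auto simp: perfect_homomorphism_def)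
    then show "s \<circ> \<pi> \<in> hom G H"
      by (auto simp: hom_def H_def \<pi>s sA Pi_iff)
    have "perfect_map TL TA s"
      using homs by (rule homeomorphic_imp_perfect_map)
    with pm show "perfect_map T TA (s \<circ> \<pi>)"
      unfolding perfect_map_def
      by (metis continuous_map_compose proper_map_compose image_comp)
  qed
  moreover have "continuous_map TA M (g \<circ> \<pi>)"
    using c\<pi> g(1) by (rule continuous_map_compose)
  moreover have "f x = (g \<circ> \<pi>) ((s \<circ> \<pi>) x)" if "x \<in> carrier G" for x
    using g(2) that \<pi>s[of "\<pi> x"] img by force
  ultimately show "\<exists>(L :: 'a monoid) TL \<pi> g. topological_group L TL \<and> second_countable TL \<and>
      perfect_homomorphism G T L TL \<pi> \<and> continuous_map TL M g \<and> (\<forall>x\<in>carrier G. f x = g (\<pi> x))"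
    by blast
qed

end

theory Submission
  imports Defs
begin

text \<open>
  Currying a map \<open>f\<close> from \<open>G \<times> K\<close> to a metric space \<open>M\<close> gives a continuous map from \<open>G\<close> to the
  metrizable space \<open>C(K, M)\<close>, which factors through a perfect homomorphism \<open>\<pi>\<close> onto a
  second-countable group \<open>L\<close>. For a countable set \<open>D\<close> in \<open>G\<close> whose image is dense in \<open>L\<close>, send
  \<open>k\<close> to the family of the functions \<open>(x, y) \<mapsto> f(d, x k y)\<close>, \<open>d \<in> D\<close>. The two-sided translations
  make the fibres of this map \<open>\<Phi>\<close> the cosets of a normal subgroup, so its image, a compact subset
  of a countable product of metrizable spaces, is a second-countable group. By density \<open>f\<close>
  factors through the perfect map \<open>\<pi> \<times> \<Phi>\<close>, which is a quotient map.
\<close>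

section \<open>Currying into spaces of continuous functions on a compact space\<close>

text \<open>Compactness of \<open>X\<close> upgrades joint continuity to uniform closeness: by the
  tube lemma, a bound that holds along a slice \<open>{z} \<times> X\<close> persists for all nearby
  slices. The restriction appears because the points of \<open>cfunspace\<close> are extensional
  functions.\<close>

lemma continuous_map_curry_cfunspace:
  assumes X: "compact_space X"
    and f: "continuous_map (prod_topology Z X) (mtopology_of m) (\<lambda>p. f (fst p) (snd p))"
  shows "continuous_map Z (mtopology_of (cfunspace X m)) (\<lambda>z. restrict (f z) (topspace X))"
proof -
  interpret C: Metric_space "mspace (cfunspace X m)" "mdist (cfunspace X m)"
    by (rule Metric_space_mspace_mdist)
  have X': "compactin X (topspace X)"
    using X by (simp add: compact_space_def)
  have fz: "continuous_map X (mtopology_of m) (f z)" if "z \<in> topspace Z" for z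
  proof -
    have "continuous_map X (prod_topology Z X) (\<lambda>x. (z, x))"
      using that by (simp add: continuous_map_paired)
    from continuous_map_compose[OF this f] show ?thesis
      by (simp add: o_def)
  qed
  have mem: "restrict (f z) (topspace X) \<in> mspace (cfunspace X m)" if "z \<in> topspace Z" for z
    \<comment> \<open>Over a compact space the boundedness demanded by \<open>cfunspace\<close> is
      automatic, so continuity and extensionality suffice.\<close>
    unfolding compactin_mspace_cfunspace[OF X']
    using fz[OF that] continuous_map_funspace[OF fz[OF that]]
    by (auto simp: Pi_iff intro: continuous_map_eq)
  have "continuous_map Z C.mtopology (\<lambda>z. restrict (f z) (topspace X))"
    unfolding C.continuous_map_to_metric
  proof (intro ballI allI impI)
    fix z \<epsilon> assume z: "z \<in> topspace Z" and \<epsilon>: "(\<epsilon>::real) > 0"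
    \<comment> \<open>The bound is \<epsilon>/2 because pointwise estimates give only a weak
      inequality for the supremum metric, whereas the ball of radius \<epsilon> is open.\<close>
    define W where "W = {p \<in> topspace (prod_topology Z X).
      mdist m (f z (snd p)) (f (fst p) (snd p)) \<in> {..<\<epsilon>/2}}"
    have "continuous_map (prod_topology Z X) (mtopology_of m) (\<lambda>p. f z (snd p))"
      using continuous_map_compose[OF continuous_map_snd fz[OF z]] by (simp add: o_def)
    then have "continuous_map (prod_topology Z X) euclideanreal
        (\<lambda>p. mdist m (f z (snd p)) (f (fst p) (snd p)))"
      using f by (rule continuous_map_mdist)
    then have "openin (prod_topology Z X) W"
      unfolding W_def by (rule openin_continuous_map_preimage) auto
    moreover have "{z} \<times> topspace X \<subseteq> W"
    proof -
      have "mdist m (f z x) (f z x) < \<epsilon>/2" if "x \<in> topspace X" for x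
      proof -
        have "f z x \<in> mspace m"
          using that continuous_map_funspace[OF fz[OF z]] by (auto simp: Pi_iff)
        then have "mdist m (f z x) (f z x) = 0"
          by simp
        with \<epsilon> show ?thesis
          by linarith
      qed
      then show ?thesis
        using z by (auto simp: W_def)
    qed
    ultimately obtain U V where U: "openin Z U" "z \<in> U" "topspace X \<subseteq> V" "U \<times> V \<subseteq> W"
      using tube_lemma_right[OF _ X' z] by metis
    have "restrict (f y) (topspace X) \<in>
        C.mball (restrict (f z) (topspace X)) \<epsilon>" if y: "y \<in> U" for y
    proof -
      have "y \<in> topspace Z"
        using y U(1) openin_subset by blast
      moreover have "mdist (cfunspace X m) (restrict (f z) (topspace X))
          (restrict (f y) (topspace X)) \<le> \<epsilon>/2"
      proof (rule mdist_cfunspace_le)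
        fix x assume "x \<in> topspace X"
        then have "(y, x) \<in> W"
          using y U by blast
        then show "mdist m (restrict (f z) (topspace X) x) (restrict (f y) (topspace X) x) \<le> \<epsilon>/2"
          using \<open>x \<in> topspace X\<close> by (simp add: W_def)
      qed (use \<epsilon> in simp)
      ultimately show ?thesis
        using mem z \<epsilon> by (auto simp: C.in_mball simp del: mspace_cfunspace)
    qed
    with U show "\<exists>U. openin Z U \<and> z \<in> U \<and> (\<forall>y\<in>U. restrict (f y) (topspace X) \<in>
        C.mball (restrict (f z) (topspace X)) \<epsilon>)"
      by blast
  qed
  then show ?thesis
    by (simp add: mtopology_of_def)
qed

section \<open>Second countability of compact metrizable spaces and of products\<close>

text \<open>Total boundedness provides a finite net for each radius 1/(n+1); the balls of these
  radii around the net points form a countable base.\<close>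

lemma compact_metrizable_imp_second_countable:
  assumes "compact_space X" "metrizable_space X"
  shows "second_countable X"
proof -
  obtain M d where "Metric_space M d" and X: "X = Metric_space.mtopology M d"
    using assms(2) metrizable_space_def by blast
  then interpret Metric_space M d
    by simp
  have "mtotally_bounded M"
    using assms(1) X compact_space_eq_mcomplete_mtotally_bounded by simp
  then have "\<forall>n. \<exists>K. finite K \<and> K \<subseteq> M \<and> M \<subseteq> (\<Union>x\<in>K. mball x (inverse (Suc n)))"
    by (simp add: mtotally_bounded_def)
  then obtain K where K: "\<And>n. finite (K n)" "\<And>n. K n \<subseteq> M"
    "\<And>n. M \<subseteq> (\<Union>x\<in>K n. mball x (inverse (Suc n)))"
    by metis
  define B where "B = (\<Union>n. (\<lambda>x. mball x (inverse (Suc n))) ` K n)"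
  show ?thesis
    unfolding second_countable_def
  proof (intro exI[of _ B] conjI ballI allI impI)
    show "countable B"
      unfolding B_def by (rule countable_UN) (simp_all add: countable_finite K(1))
    show "openin X V" if "V \<in> B" for V
      using that by (auto simp: B_def X)
  next
    fix U x assume "openin X U \<and> x \<in> U"
    then obtain r where r: "r > 0" "mball x r \<subseteq> U" "x \<in> M"
      using openin_mtopology X by (metis openin_subset subsetD topspace_mtopology)
    \<comment> \<open>With a radius below r/2, any net ball that contains \<open>x\<close> stays
      inside the ball of radius \<open>r\<close> around \<open>x\<close>.\<close>
    obtain n where n: "inverse (real (Suc n)) < r/2"
      using reals_Archimedean[of "r/2"] r by auto
    obtain c where c: "c \<in> K n" "x \<in> mball c (inverse (Suc n))"
      using K(3)[of n] r(3) by blast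
    have "mball c (inverse (Suc n)) \<subseteq> mball x r"
    proof
      fix y assume y: "y \<in> mball c (inverse (Suc n))"
      then have "d x y \<le> d x c + d c y"
        using c(2) by (intro triangle) auto
      then show "y \<in> mball x r"
        using c(2) y n commute[of x c] by auto
    qed
    then show "\<exists>V\<in>B. x \<in> V \<and> V \<subseteq> U"
      using c r(2) by (auto simp: B_def)
  qed
qed

lemma second_countable_prod_topology:
  assumes "second_countable X" "second_countable Y"
  shows "second_countable (prod_topology X Y)"
proof -
  obtain A where A: "countable A" "\<And>V. V \<in> A \<Longrightarrow> openin X V"
    "\<And>U x. openin X U \<Longrightarrow> x \<in> U \<Longrightarrow> \<exists>V\<in>A. x \<in> V \<and> V \<subseteq> U"
    using assms(1) unfolding second_countable_def by metis
  obtain B where B: "countable B" "\<And>V. V \<in> B \<Longrightarrow> openin Y V"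
    "\<And>U x. openin Y U \<Longrightarrow> x \<in> U \<Longrightarrow> \<exists>V\<in>B. x \<in> V \<and> V \<subseteq> U"
    using assms(2) unfolding second_countable_def by metis
  show ?thesis
    unfolding second_countable_def
  proof (intro exI[of _ "(\<lambda>(V, W). V \<times> W) ` (A \<times> B)"] conjI ballI allI impI)
    show "countable ((\<lambda>(V, W). V \<times> W) ` (A \<times> B))"
      using A(1) B(1) by simp
    show "openin (prod_topology X Y) V" if "V \<in> (\<lambda>(V, W). V \<times> W) ` (A \<times> B)" for V
      using that A(2) B(2) by (auto simp: openin_prod_Times_iff)
  next
    fix S z assume z: "openin (prod_topology X Y) S \<and> z \<in> S"
    then obtain U V where UV: "openin X U" "openin Y V" "fst z \<in> U" "snd z \<in> V" "U \<times> V \<subseteq> S"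
      unfolding openin_prod_topology_alt by (metis prod.collapse)
    obtain U' V' where "U' \<in> A" "fst z \<in> U'" "U' \<subseteq> U" "V' \<in> B" "snd z \<in> V'" "V' \<subseteq> V"
      using A(3)[OF UV(1,3)] B(3)[OF UV(2,4)] by blast
    then have "U' \<times> V' \<in> (\<lambda>(V, W). V \<times> W) ` (A \<times> B)" "z \<in> U' \<times> V'" "U' \<times> V' \<subseteq> S"
      using UV(5) by (auto simp: mem_Times_iff)
    then show "\<exists>V\<in>(\<lambda>(V, W). V \<times> W) ` (A \<times> B). z \<in> V \<and> V \<subseteq> S"
      by blast
  qed
qed

section \<open>Perfect maps and topological groups\<close>

text \<open>Products of closed maps need not be closed; it is properness, that is, closedness
  together with compact fibres, that passes to products.\<close>

lemma perfect_map_prod: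
  assumes "perfect_map X X' f" "perfect_map Y Y' g"
  shows "perfect_map (prod_topology X Y) (prod_topology X' Y') (\<lambda>(x, y). (f x, g y))"
  using assms unfolding perfect_map_def continuous_map_prod_top proper_map_prod
  by (auto simp: image_paired_Times)

context topological_group
begin

lemma continuous_map_mult:
  assumes "continuous_map X T f" "continuous_map X T g"
  shows "continuous_map X T (\<lambda>x. f x \<otimes> g x)"
  using continuous_map_compose[OF continuous_map_pairedI[OF assms] continuous_mult]
  by (simp add: o_def)

lemma continuous_map_inv:
  assumes "continuous_map X T f"
  shows "continuous_map X T (\<lambda>x. inv (f x))"
  using continuous_map_compose[OF assms continuous_inv] by (simp add: o_def)

text \<open>The hypothesis \<open>cong\<close> lets the multiplication descend along
  \<open>\<pi>\<close>. Continuity descends too, because \<open>\<pi>\<close> and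
  \<open>\<pi> \<times> \<pi>\<close> are perfect and hence quotient maps; for a mere quotient map
  the square could fail to be one.\<close>

lemma topological_group_perfect_image:
  fixes Y :: "'l topology"
  assumes \<pi>: "perfect_map T Y \<pi>" and Y: "Hausdorff_space Y"
    and cong: "\<And>a b x y. \<lbrakk>a \<in> carrier G; b \<in> carrier G; x \<in> carrier G; y \<in> carrier G;
      \<pi> a = \<pi> b; \<pi> x = \<pi> y\<rbrakk> \<Longrightarrow> \<pi> (a \<otimes> x) = \<pi> (b \<otimes> y)"
  obtains L :: "'l monoid" where "topological_group L Y" "\<pi> \<in> hom G L"
proof -
  \<comment> \<open>An arbitrary section, with no continuity claimed; by \<open>cong\<close> the
    product of two classes does not depend on the representatives it picks.\<close>
  define s where "s = inv_into (carrier G) \<pi>"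
  define L :: "'l monoid" where
    "L = \<lparr>carrier = topspace Y, mult = (\<lambda>y z. \<pi> (s y \<otimes> s z)), one = \<pi> \<one>\<rparr>"
  have im: "\<pi> ` carrier G = carrier L"
    using \<pi> by (simp add: perfect_map_def topspace_eq L_def)
  have s: "s (\<pi> x) \<in> carrier G" "\<pi> (s (\<pi> x)) = \<pi> x" if "x \<in> carrier G" for x
    using that unfolding s_def by (auto intro: inv_into_into f_inv_into_f)
  have mult: "\<pi> x \<otimes>\<^bsub>L\<^esub> \<pi> y = \<pi> (x \<otimes> y)" if "x \<in> carrier G" "y \<in> carrier G" for x y
    using that s by (auto simp: L_def intro: cong)
  have one: "\<one>\<^bsub>L\<^esub> = \<pi> \<one>"
    by (simp add: L_def)
  have grp: "group L"
  \<comment> \<open>Writing the carrier as the image of \<open>\<pi>\<close> reduces every group law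
    to the same law for representatives in \<open>G\<close>.\<close>
  proof (rule groupI; (unfold im[symmetric])?)
    show "\<exists>y\<in>\<pi> ` carrier G. y \<otimes>\<^bsub>L\<^esub> x = \<one>\<^bsub>L\<^esub>" if x: "x \<in> \<pi> ` carrier G" for x
    proof -
      obtain a where a: "a \<in> carrier G" "x = \<pi> a"
        using x by blast
      then have "\<pi> (inv a) \<otimes>\<^bsub>L\<^esub> x = \<one>\<^bsub>L\<^esub>"
        by (simp add: mult one)
      then show ?thesis
        using a by blast
    qed
  qed (auto simp: mult one m_assoc)
  interpret L: group L by (rule grp)
  have inv: "inv\<^bsub>L\<^esub> (\<pi> x) = \<pi> (inv x)" if "x \<in> carrier G" for x
    by (rule L.inv_equality) (use that im in \<open>auto simp: mult one\<close>)
  have q: "quotient_map T Y \<pi>"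
    using \<pi> by (rule perfect_imp_quotient_map)
  have q2: "quotient_map (prod_topology T T) (prod_topology Y Y) (\<lambda>(x, y). (\<pi> x, \<pi> y))"
    using \<pi> by (intro perfect_imp_quotient_map perfect_map_prod)
  have c: "continuous_map T Y \<pi>"
    using \<pi> by (simp add: perfect_map_def)
  have "topological_group L Y"
  proof unfold_locales
    show "topspace Y = carrier L"
      by (simp add: L_def)
    show "continuous_map (prod_topology Y Y) Y (\<lambda>(x, y). x \<otimes>\<^bsub>L\<^esub> y)"
    proof (rule continuous_compose_quotient_map[OF q2])
      show "continuous_map (prod_topology T T) Y
          ((\<lambda>(x, y). x \<otimes>\<^bsub>L\<^esub> y) \<circ> (\<lambda>(x, y). (\<pi> x, \<pi> y)))"
        by (rule continuous_map_eq[OF continuous_map_compose[OF continuous_mult c]])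
          (auto simp: topspace_eq mult)
    qed
    show "continuous_map Y Y (\<lambda>x. inv\<^bsub>L\<^esub> x)"
    proof (rule continuous_compose_quotient_map[OF q])
      show "continuous_map T Y ((\<lambda>x. inv\<^bsub>L\<^esub> x) \<circ> \<pi>)"
        by (rule continuous_map_eq[OF continuous_map_compose[OF continuous_inv c]])
          (simp add: topspace_eq inv)
    qed
  qed (rule Y)
  moreover have "\<pi> \<in> hom G L"
    using im by (auto simp: hom_def mult)
  ultimately show thesis
    by (rule that)
qed

end

lemma topological_group_DirProd:
  assumes "topological_group G TG" "topological_group K TK"
  shows "topological_group (G \<times>\<times> K) (prod_topology TG TK)"
proof -
  interpret G: topological_group G TG by (rule assms(1))
  interpret K: topological_group K TK by (rule assms(2))
  interpret GK: group "G \<times>\<times> K"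
    by (rule DirProd_group[OF G.group_axioms K.group_axioms])
  let ?T = "prod_topology TG TK"
  note projections =
    continuous_map_compose[OF continuous_map_fst continuous_map_fst, unfolded o_def]
    continuous_map_compose[OF continuous_map_fst continuous_map_snd, unfolded o_def]
    continuous_map_compose[OF continuous_map_snd continuous_map_fst, unfolded o_def]
    continuous_map_compose[OF continuous_map_snd continuous_map_snd, unfolded o_def]
  show ?thesis
  proof unfold_locales
    show "topspace ?T = carrier (G \<times>\<times> K)"
      by (simp add: G.topspace_eq K.topspace_eq)
    show "Hausdorff_space ?T"
      by (simp add: Hausdorff_space_prod_topology G.Hausdorff K.Hausdorff)
    have "continuous_map (prod_topology ?T ?T) ?T
        (\<lambda>p. (fst (fst p) \<otimes>\<^bsub>G\<^esub> fst (snd p), snd (fst p) \<otimes>\<^bsub>K\<^esub> snd (snd p)))"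
      by (intro continuous_map_pairedI G.continuous_map_mult K.continuous_map_mult projections)
    then show "continuous_map (prod_topology ?T ?T) ?T (\<lambda>(x, y). x \<otimes>\<^bsub>G \<times>\<times> K\<^esub> y)"
      by (simp add: mult_DirProd' case_prod_beta')
    have "continuous_map ?T ?T (\<lambda>p. (inv\<^bsub>G\<^esub> (fst p), inv\<^bsub>K\<^esub> (snd p)))"
      by (intro continuous_map_pairedI G.continuous_map_inv K.continuous_map_inv
          continuous_map_fst continuous_map_snd)
    then show "continuous_map ?T ?T (\<lambda>x. inv\<^bsub>G \<times>\<times> K\<^esub> x)"
      by (rule continuous_map_eq)
        (auto simp: G.topspace_eq K.topspace_eq inv_DirProd G.group_axioms K.group_axioms)
  qed
qed

theorem theorem5p10:
  fixes G :: "('a, 'c) monoid_scheme" and TG :: "'a topology"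
    and K :: "('b, 'd) monoid_scheme" and TK :: "'b topology"
  assumes "Pm_factorizable G TG"
    and "topological_group K TK" and "compact_space TK"
  shows "Pm_factorizable (G \<times>\<times> K) (prod_topology TG TK)"
proof (rule Pm_factorizableI)
  have GG: "topological_group G TG"
    using assms(1) by (simp add: Pm_factorizable_def)
  interpret G: topological_group G TG by (rule GG)
  interpret K: topological_group K TK by (rule assms(2))
  let ?T = "prod_topology TG TK"
  let ?KK = "prod_topology TK TK"
  show "topological_group (G \<times>\<times> K) ?T"
    using GG assms(2) by (rule topological_group_DirProd)
  fix M :: "('a \<times> 'b) topology" and f
  assume met: "metrizable_space M" and f: "continuous_map ?T M f"
  \<comment> \<open>A metric is fixed because the function spaces below carry the supremum metric
    derived from it.\<close>
  obtain m where m: "M = mtopology_of m"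
    using met Metric_space.mtopology_of unfolding metrizable_space_def by metis
  have met_C: "metrizable_space (mtopology_of (cfunspace X m))" for X :: "'x topology"
    unfolding mtopology_of_def
    by (rule Metric_space.metrizable_space_mtopology[OF Metric_space_mspace_mdist])

  define F where "F = (\<lambda>z. \<lambda>k\<in>topspace TK. f (z, k))"
  have "continuous_map TG (mtopology_of (cfunspace TK m)) F"
    unfolding F_def using assms(3) f
    by (intro continuous_map_curry_cfunspace) (simp_all add: m)
  from Pm_factorizableD[OF assms(1) met_C this]
  obtain L :: "'a monoid" and TL \<pi> g where
    L: "topological_group L TL" and sc: "second_countable TL"
    and \<pi>: "perfect_homomorphism G TG L TL \<pi>" and F: "\<And>x. x \<in> carrier G \<Longrightarrow> F x = g (\<pi> x)"
    by blast
  have pm: "perfect_map TG TL \<pi>" and hom: "\<pi> \<in> hom G L"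
    using \<pi> by (auto simp: perfect_homomorphism_def)
  have im: "\<pi> ` carrier G = topspace TL"
    using pm by (simp add: perfect_map_def G.topspace_eq)
  \<comment> \<open>Equal images under \<open>\<pi>\<close> force equal curried functions
    \<open>F x\<close> and \<open>F y\<close>, hence equal values of \<open>f\<close> at every
    \<open>k\<close>.\<close>
  have f_\<pi>: "f (x, k) = f (y, k)"
    if "x \<in> carrier G" "y \<in> carrier G" "k \<in> carrier K" "\<pi> x = \<pi> y" for x y k
  proof -
    have "F x k = F y k"
      using F that by simp
    then show ?thesis
      using that by (simp add: F_def K.topspace_eq)
  qed

  obtain D where D: "countable D" "D \<subseteq> topspace TL" "TL closure_of D = topspace TL"
    using second_countable_imp_separable_space[OF sc] by (auto simp: separable_space_def)
  \<comment> \<open>One preimage in \<open>G\<close> is chosen for each point of \<open>D\<close>.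
    Countability of this index set keeps the product \<open>P\<close> metrizable.\<close>
  define D' where "D' = inv_into (carrier G) \<pi> ` D"
  have D': "countable D'" "D' \<subseteq> carrier G" "\<pi> ` D' = D"
    using D im by (auto simp: D'_def image_image f_inv_into_f inv_into_into subset_iff)

  \<comment> \<open>The pair of units recovers \<open>f (d, k)\<close>; the other pairs make
    equality under \<open>\<Phi>\<close> compatible with multiplication on both sides.\<close>
  define \<Phi> where "\<Phi> = (\<lambda>k. \<lambda>d\<in>D'. \<lambda>p\<in>topspace ?KK. f (d, fst p \<otimes>\<^bsub>K\<^esub> k \<otimes>\<^bsub>K\<^esub> snd p))"
  define P where "P = product_topology (\<lambda>d. mtopology_of (cfunspace ?KK m)) D'"
  define Q where "Q = subtopology P (\<Phi> ` carrier K)"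
  have "continuous_map TK P \<Phi>"
    unfolding P_def continuous_map_componentwise
  proof (intro conjI ballI)
    fix d assume d: "d \<in> D'"
    have "continuous_map TK (mtopology_of (cfunspace ?KK m))
        (\<lambda>k. \<lambda>p\<in>topspace ?KK. f (d, fst p \<otimes>\<^bsub>K\<^esub> k \<otimes>\<^bsub>K\<^esub> snd p))"
    proof (rule continuous_map_curry_cfunspace)
      show "compact_space ?KK"
        using assms(3) by (simp add: compact_space_prod_topology)
      have "continuous_map (prod_topology TK ?KK) ?T
          (\<lambda>p. (d, fst (snd p) \<otimes>\<^bsub>K\<^esub> fst p \<otimes>\<^bsub>K\<^esub> snd (snd p)))"
        using d D'(2) G.topspace_eq
        by (intro continuous_map_pairedI K.continuous_map_mult continuous_map_fst
            continuous_map_compose[OF continuous_map_snd continuous_map_fst, unfolded o_def]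
            continuous_map_compose[OF continuous_map_snd continuous_map_snd, unfolded o_def]) auto
      from continuous_map_compose[OF this f]
      show "continuous_map (prod_topology TK ?KK) (mtopology_of m)
          (\<lambda>p. f (d, fst (snd p) \<otimes>\<^bsub>K\<^esub> fst p \<otimes>\<^bsub>K\<^esub> snd (snd p)))"
        by (simp add: o_def m)
    qed
    then show "continuous_map TK (mtopology_of (cfunspace ?KK m)) (\<lambda>k. \<Phi> k d)"
      using d by (simp add: \<Phi>_def)
  qed (auto simp: \<Phi>_def)
  then have c\<Phi>: "continuous_map TK Q \<Phi>"
    by (simp add: Q_def continuous_map_in_subtopology K.topspace_eq)
  have "\<Phi> ` carrier K \<subseteq> topspace P"
    using \<open>continuous_map TK P \<Phi>\<close> continuous_map_image_subset_topspace K.topspace_eq by metis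
  then have topQ: "\<Phi> ` topspace TK = topspace Q"
    by (auto simp: Q_def K.topspace_eq)
  have "metrizable_space P"
    unfolding P_def metrizable_space_product_topology
    using D'(1) met_C by (auto intro: countable_subset)
  then have metQ: "metrizable_space Q"
    unfolding Q_def by (rule metrizable_space_subtopology)
  then have HQ: "Hausdorff_space Q"
    by (rule metrizable_imp_Hausdorff_space)
  have "compact_space Q"
    using image_compactin[OF _ c\<Phi>, of "topspace TK"] assms(3) topQ by (simp add: compact_space_def)
  then have scQ: "second_countable Q"
    using metQ by (rule compact_metrizable_imp_second_countable)
  \<comment> \<open>A continuous map from a compact space to a Hausdorff space is proper.\<close>
  have pm\<Phi>: "perfect_map TK Q \<Phi>"
    unfolding perfect_map_def
    using c\<Phi> topQ HQ assms(3) by (simp add: continuous_imp_proper_map Hausdorff_imp_kc_space)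

  have f_\<Phi>: "f (d, x \<otimes>\<^bsub>K\<^esub> k \<otimes>\<^bsub>K\<^esub> y) = f (d, x \<otimes>\<^bsub>K\<^esub> l \<otimes>\<^bsub>K\<^esub> y)"
    if "\<Phi> k = \<Phi> l" "d \<in> D'" "x \<in> carrier K" "y \<in> carrier K" for d x y k l
  proof -
    have "\<Phi> k d (x, y) = \<Phi> l d (x, y)"
      using that by simp
    then show ?thesis
      using that by (simp add: \<Phi>_def K.topspace_eq)
  qed
  have cong: "\<Phi> (k \<otimes>\<^bsub>K\<^esub> x) = \<Phi> (l \<otimes>\<^bsub>K\<^esub> y)"
    if K: "k \<in> carrier K" "l \<in> carrier K" "x \<in> carrier K" "y \<in> carrier K"
      and eq: "\<Phi> k = \<Phi> l" "\<Phi> x = \<Phi> y" for k l x y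
  proof -
    \<comment> \<open>One factor is changed at a time: first \<open>k\<close> to \<open>l\<close>,
      with \<open>x \<otimes> b\<close> as right translator, then \<open>x\<close> to
      \<open>y\<close>, with \<open>a \<otimes> l\<close> as left translator.\<close>
    have "f (d, a \<otimes>\<^bsub>K\<^esub> (k \<otimes>\<^bsub>K\<^esub> x) \<otimes>\<^bsub>K\<^esub> b) = f (d, a \<otimes>\<^bsub>K\<^esub> (l \<otimes>\<^bsub>K\<^esub> y) \<otimes>\<^bsub>K\<^esub> b)"
      if d: "d \<in> D'" and ab: "a \<in> carrier K" "b \<in> carrier K" for d a b
      using f_\<Phi>[OF eq(1) d ab(1), of "x \<otimes>\<^bsub>K\<^esub> b"] f_\<Phi>[OF eq(2) d _ ab(2), of "a \<otimes>\<^bsub>K\<^esub> l"] K ab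
      by (simp add: K.m_assoc)
    then show ?thesis
      by (auto simp: \<Phi>_def K.topspace_eq intro!: restrict_ext)
  qed
  \<comment> \<open>The elements are the values of \<open>\<Phi>\<close>, hence the type;
    \<open>Pm_factorizableI\<close> leaves the type of the factor group free.\<close>
  obtain H :: "('a \<Rightarrow> 'b \<times> 'b \<Rightarrow> 'a \<times> 'b) monoid" where
    H: "topological_group H Q" and hom\<Phi>: "\<Phi> \<in> hom K H"
    using K.topological_group_perfect_image[OF pm\<Phi> HQ cong] by blast

  have fact: "f (x, k) = f (y, l)"
    if K: "x \<in> carrier G" "y \<in> carrier G" "k \<in> carrier K" "l \<in> carrier K"
      and eq: "\<pi> x = \<pi> y" "\<Phi> k = \<Phi> l" for x y k l
  proof -
    \<comment> \<open>\<open>D'\<close> need not be dense in \<open>G\<close>, so the density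
      argument takes place in \<open>L\<close>: \<open>E\<close> is closed as an equalizer, its
      image under the closed map \<open>\<pi>\<close> is closed and contains the dense set
      \<open>D\<close>, and so \<open>E\<close> meets every fibre of \<open>\<pi>\<close>.\<close>
    define E where "E = {z \<in> topspace TG. f (z, k) = f (z, l)}"
    have "continuous_map TG M (\<lambda>z. f (z, j))" if "j \<in> carrier K" for j
    proof -
      have "continuous_map TG ?T (\<lambda>z. (z, j))"
        using that by (simp add: continuous_map_paired K.topspace_eq)
      from continuous_map_compose[OF this f] show ?thesis
        by (simp add: o_def)
    qed
    then have "closedin TG E"
      unfolding E_def using K met
      by (intro closedin_continuous_maps_eq[OF metrizable_imp_Hausdorff_space]) auto
    then have "closedin TL (\<pi> ` E)"
      using pm by (simp add: perfect_map_def proper_map_def closed_map_def)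
    moreover have "D' \<subseteq> E"
      using D'(2) K f_\<Phi>[OF eq(2), of _ "\<one>\<^bsub>K\<^esub>" "\<one>\<^bsub>K\<^esub>"] by (auto simp: E_def G.topspace_eq)
    then have "D \<subseteq> \<pi> ` E"
      using D'(3) by blast
    ultimately have "topspace TL \<subseteq> \<pi> ` E"
      using closure_of_minimal D(3) by metis
    then obtain e where e: "e \<in> carrier G" "f (e, k) = f (e, l)" "\<pi> e = \<pi> y"
      using K im by (force simp: E_def G.topspace_eq)
    \<comment> \<open>The point \<open>e\<close> of \<open>E\<close> in the common fibre of
      \<open>x\<close> and \<open>y\<close> allows the second coordinate to change from
      \<open>k\<close> to \<open>l\<close>; moving within the fibre costs nothing by
      \<open>f_\<pi>\<close>.\<close>
    have "f (x, k) = f (e, k)"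
      using K e eq by (intro f_\<pi>) auto
    also have "\<dots> = f (y, l)"
      using K e f_\<pi>[of e y l] by simp
    finally show ?thesis .
  qed

  define \<rho> where "\<rho> = (\<lambda>(x, k). (\<pi> x, \<Phi> k))"
  have pm\<rho>: "perfect_map ?T (prod_topology TL Q) \<rho>"
    unfolding \<rho>_def using pm pm\<Phi> by (rule perfect_map_prod)
  have "\<rho> \<in> hom (G \<times>\<times> K) (L \<times>\<times> H)"
    using hom hom\<Phi> by (auto simp: hom_def \<rho>_def)
  with pm\<rho> have "perfect_homomorphism (G \<times>\<times> K) ?T (L \<times>\<times> H) (prod_topology TL Q) \<rho>"
    by (simp add: perfect_homomorphism_def)
  \<comment> \<open>Constancy of \<open>f\<close> on the fibres of the quotient map
    \<open>\<rho>\<close> yields the continuous factor \<open>h\<close>.\<close>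
  moreover have "f z = f w"
    if "z \<in> topspace ?T" "w \<in> topspace ?T" "\<rho> z = \<rho> w" for z w
    using that fact[of "fst z" "fst w" "snd z" "snd w"]
    by (auto simp: \<rho>_def G.topspace_eq K.topspace_eq)
  then obtain h where "continuous_map (prod_topology TL Q) M h"
    and "\<And>z. z \<in> topspace ?T \<Longrightarrow> h (\<rho> z) = f z"
    using quotient_map_lift_exists[OF perfect_imp_quotient_map[OF pm\<rho>] f] by metis
  then have "continuous_map (prod_topology TL Q) M h \<and> (\<forall>x\<in>carrier (G \<times>\<times> K). f x = h (\<rho> x))"
    by (simp add: G.topspace_eq K.topspace_eq)
  moreover have "topological_group (L \<times>\<times> H) (prod_topology TL Q)"
    using L H by (rule topological_group_DirProd)
  moreover have "second_countable (prod_topology TL Q)"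
    using sc scQ by (rule second_countable_prod_topology)
  ultimately show "\<exists>(L :: ('a \<times> ('a \<Rightarrow> 'b \<times> 'b \<Rightarrow> 'a \<times> 'b)) monoid) TL \<pi> g.
      topological_group L TL \<and> second_countable TL \<and>
      perfect_homomorphism (G \<times>\<times> K) ?T L TL \<pi> \<and>
      continuous_map TL M g \<and> (\<forall>x\<in>carrier (G \<times>\<times> K). f x = g (\<pi> x))"
    by blast
qed

end
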